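(* Vizing's conjecture (that $\gamma(G)\gamma(H)\le\gamma(G\Box H)$ for all finite graphs $G,H$) is true if and only if for all positive integers $n_\mathcal{G},k_\mathcal{G},n_\mathcal{H},k_\mathcal{H}$ with $k_\mathcal{G}\le n_\mathcal{G}$ and $k_\mathcal{H}\le n_\mathcal{H}$, the polynomial $f_{\mathrm{viz}}$ is non-negative on $\mathcal{V}(I_{\mathrm{viz}})$, i.e. $f_{\mathrm{viz}}(z^\ast)\ge 0$ for all $z^\ast\in\mathcal{V}(I_{\mathrm{viz}})$.
   Context: $\gamma(G)$ is the domination number (minimum size of a set $D$ of vertices such that every vertex outside $D$ has a neighbor in $D$); $G\Box H$ is the Cartesian product graph (vertex set $V(G)\times V(H)$, $gh\sim g'h'$ iff $g=g'$ and $hh'\in E(H)$, or $h=h'$ and $gg'\in E(G)$). $\mathbb{K}$ is a subfield of $\mathbb{R}$. For given $n_\mathcal{G},k_\mathcal{G},n_\mathcal{H},k_\mathcal{H}$: $V(\mathcal{G})$ is a set of $n_\mathcal{G}$ vertices with fixed subset $D_\mathcal{G}$ of size $k_\mathcal{G}$; $V(\mathcal{H})$ a disjoint set of $n_\mathcal{H}$ vertices with fixed subset $D_\mathcal{H}$ of size $k_\mathcal{H}$. Variables $e_{gg'}=e_{g'g}$ for 2-subsets of $V(\mathcal{G})$, $e_{hh'}$ for 2-subsets of $V(\mathcal{H})$, $x_{gh}$ for $g\in V(\mathcal{G}),h\in V(\mathcal{H})$; $P$ is the polynomial ring over $\mathbb{K}$ in these. $I_{\mathrm{viz}}\subseteq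 P$ is generated by: $e_{gg'}^2-e_{gg'}$; $\prod_{g'\in D_\mathcal{G}}(1-e_{gg'})$ for $g\notin D_\mathcal{G}$; $\prod_{g'\in V(\mathcal{G})\setminus S}\sum_{g\in S}e_{gg'}$ for $S\subseteq V(\mathcal{G})$, $|S|=k_\mathcal{G}-1$; the same three families for $\mathcal{H}$ (with $V(\mathcal{H}),D_\mathcal{H},k_\mathcal{H}$); $x_{gh}^2-x_{gh}$; and $(1-x_{gh})\prod_{g'\ne g}(1-e_{gg'}x_{g'h})\prod_{h'\ne h}(1-e_{hh'}x_{gh'})$ for all $g,h$. $\mathcal{V}(I)$ denotes the set of common zeros over $\overline{\mathbb{K}}$. $f_{\mathrm{viz}}=\sum_{g\in V(\mathcal{G}),h\in V(\mathcal{H})}x_{gh}-k_\mathcal{G}k_\mathcal{H}$. *)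

theory Defs
  imports
    Complex_Main
    "HOL-Library.Poly_Mapping"
    "HOL-Library.FuncSet"
    "HOL-Library.Nonpos_Ints"
    "HOL-Computational_Algebra.Polynomial"
    "Graph_Theory.Pair_Digraph"
begin

section \<open>Domination number, Cartesian product, Vizing's conjecture\<close>

text \<open>A finite simple graph is a \<open>pair_graph\<close>: the vertex set is \<open>pverts G\<close>, and an
  edge $uv$ is represented by the two arcs $(u,v)$ and $(v,u)$ in \<open>parcs G\<close>.\<close>

definition dominating :: "'a pair_pre_digraph \<Rightarrow> 'a set \<Rightarrow> bool" where
  "dominating G D \<longleftrightarrow>
     D \<subseteq> pverts G \<and> (\<forall>v \<in> pverts G - D. \<exists>d \<in> D. (v, d) \<in> parcs G)"

definition domination_number :: "'a pair_pre_digraph \<Rightarrow> nat" where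
  "domination_number G = Min {card D | D. dominating G D}"

definition cart_prod ::
    "'a pair_pre_digraph \<Rightarrow> 'b pair_pre_digraph \<Rightarrow> ('a \<times> 'b) pair_pre_digraph" where
  "cart_prod G H =
     \<lparr> pverts = pverts G \<times> pverts H,
       parcs = {((g, h), (g', h')) | g h g' h'.
                  (g = g' \<and> g \<in> pverts G \<and> (h, h') \<in> parcs H) \<or>
                  (h = h' \<and> h \<in> pverts H \<and> (g, g') \<in> parcs G)} \<rparr>"

text \<open>Vertices are natural numbers because a closed formula cannot quantify over types;
  every finite graph is isomorphic to such a graph, and \<open>vizing_conjectureD\<close> below
  recovers the inequality for vertices of arbitrary types.\<close>

definition vizing_conjecture :: bool where
  "vizing_conjecture \<longleftrightarrow>
     (\<forall>(G :: nat pair_pre_digraph) (H :: nat pair_pre_digraph).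
        pair_graph G \<longrightarrow> pair_graph H \<longrightarrow>
        domination_number G * domination_number H \<le> domination_number (cart_prod G H))"

definition map_graph :: "('a \<Rightarrow> 'b) \<Rightarrow> 'a pair_pre_digraph \<Rightarrow> 'b pair_pre_digraph" where
  "map_graph f G = \<lparr> pverts = f ` pverts G, parcs = map_prod f f ` parcs G \<rparr>"

lemma map_graph_simps [simp]:
  "pverts (map_graph f G) = f ` pverts G"
  "parcs (map_graph f G) = map_prod f f ` parcs G"
  by (simp_all add: map_graph_def)

lemma pair_graph_iff:
  "pair_graph G \<longleftrightarrow>
     finite (pverts G) \<and> parcs G \<subseteq> pverts G \<times> pverts G \<and> sym (parcs G) \<and> irrefl (parcs G)"
  (is "_ \<longleftrightarrow> ?R")
proof
  assume "pair_graph G"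
  then interpret pair_graph G .
  have "sym (parcs G)" using pair_sym_arcs by (simp add: symmetric_def)
  moreover have "irrefl (parcs G)" using pair_no_loops by (fastforce simp: irrefl_def)
  ultimately show ?R
    using pair_finite_verts in_arcsD1 in_arcsD2 by auto
next
  assume R: ?R
  then have "finite (parcs G)" by (meson finite_SigmaI finite_subset)
  with R show "pair_graph G"
    by unfold_locales (auto simp: symmetric_def irrefl_def)
qed

lemma parcs_cart_prod_iff:
  "((g, h), (g', h')) \<in> parcs (cart_prod G H) \<longleftrightarrow>
     (g = g' \<and> g \<in> pverts G \<and> (h, h') \<in> parcs H) \<or>
     (h = h' \<and> h \<in> pverts H \<and> (g, g') \<in> parcs G)"
  by (auto simp: cart_prod_def)

lemma pair_graph_cart_prod:
  assumes "pair_graph G" "pair_graph H"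
  shows "pair_graph (cart_prod G H)"
proof -
  have G: "finite (pverts G)" "parcs G \<subseteq> pverts G \<times> pverts G" "sym (parcs G)" "irrefl (parcs G)"
    and H: "finite (pverts H)" "parcs H \<subseteq> pverts H \<times> pverts H" "sym (parcs H)" "irrefl (parcs H)"
    using assms by (auto simp: pair_graph_iff)
  have "finite (pverts (cart_prod G H))"
    using G(1) H(1) by (simp add: cart_prod_def)
  moreover have "parcs (cart_prod G H) \<subseteq> pverts (cart_prod G H) \<times> pverts (cart_prod G H)"
    using G(2) H(2) by (auto simp: cart_prod_def)
  moreover have "sym (parcs (cart_prod G H))"
    using G(3) H(3) by (auto intro!: symI simp: parcs_cart_prod_iff dest: symD)
  moreover have "irrefl (parcs (cart_prod G H))"
    using G(4) H(4) by (auto simp: irrefl_def parcs_cart_prod_iff)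
  ultimately show ?thesis by (simp add: pair_graph_iff)
qed

lemma pair_graph_map_graph:
  assumes "pair_graph G" "inj_on f (pverts G)"
  shows "pair_graph (map_graph f G)"
proof -
  have G: "finite (pverts G)" "parcs G \<subseteq> pverts G \<times> pverts G" "sym (parcs G)" "irrefl (parcs G)"
    using assms(1) by (auto simp: pair_graph_iff)
  have "sym (map_prod f f ` parcs G)"
  proof (rule symI)
    fix a b assume "(a, b) \<in> map_prod f f ` parcs G"
    then obtain u v where uv: "(u, v) \<in> parcs G" "a = f u" "b = f v" by auto
    then have "(v, u) \<in> parcs G" using G(3) by (meson symD)
    then have "map_prod f f (v, u) \<in> map_prod f f ` parcs G" by (rule imageI)
    with uv show "(b, a) \<in> map_prod f f ` parcs G" by simp
  qed
  moreover have "irrefl (map_prod f f ` parcs G)"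
    unfolding irrefl_def
  proof (intro allI notI)
    fix a assume "(a, a) \<in> map_prod f f ` parcs G"
    then obtain u v where uv: "(u, v) \<in> parcs G" "a = f u" "a = f v" by auto
    then have "u = v" using assms(2) G(2) by (auto dest: inj_onD)
    with uv G(4) show False by (auto simp: irrefl_def)
  qed
  moreover have "map_prod f f ` parcs G \<subseteq> f ` pverts G \<times> f ` pverts G"
    using G(2) by auto
  ultimately show ?thesis using G(1) by (simp add: pair_graph_iff)
qed

lemma dominating_map_graph:
  assumes w: "parcs G \<subseteq> pverts G \<times> pverts G" and i: "inj_on f (pverts G)"
    and D: "D \<subseteq> pverts G"
  shows "dominating (map_graph f G) (f ` D) \<longleftrightarrow> dominating G D"
proof -
  have 1: "(f u, f v) \<in> map_prod f f ` parcs G \<longleftrightarrow> (u, v) \<in> parcs G"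
    if "u \<in> pverts G" "v \<in> pverts G" for u v
  proof
    assume "(f u, f v) \<in> map_prod f f ` parcs G"
    then obtain a b where ab: "(a, b) \<in> parcs G" "f u = f a" "f v = f b" by auto
    then have "u = a" "v = b" using that w inj_onD[OF i] by blast+
    with ab show "(u, v) \<in> parcs G" by simp
  next
    assume "(u, v) \<in> parcs G"
    from imageI[OF this, of "map_prod f f"]
    show "(f u, f v) \<in> map_prod f f ` parcs G" by simp
  qed
  have 2: "f ` pverts G - f ` D = f ` (pverts G - D)"
    using inj_on_image_set_diff[OF i _ D, of "pverts G"] by simp
  have 3: "(\<exists>d \<in> D. (f v, f d) \<in> map_prod f f ` parcs G) \<longleftrightarrow> (\<exists>d \<in> D. (v, d) \<in> parcs G)"
    if "v \<in> pverts G" for v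
    using that D 1 by (meson subsetD)
  show ?thesis unfolding dominating_def map_graph_simps 2
    using D 3 by (simp add: image_mono)
qed

lemma domination_number_map_graph:
  assumes w: "parcs G \<subseteq> pverts G \<times> pverts G" and i: "inj_on f (pverts G)"
  shows "domination_number (map_graph f G) = domination_number G"
proof -
  have c: "card (f ` D) = card D" if "D \<subseteq> pverts G" for D
    using i that by (meson card_image inj_on_subset)
  have "n \<in> {card D | D. dominating (map_graph f G) D} \<longleftrightarrow> n \<in> {card D | D. dominating G D}" for n
  proof
    assume "n \<in> {card D | D. dominating (map_graph f G) D}"
    then obtain D where D: "n = card D" "dominating (map_graph f G) D" by blast
    then have "D \<subseteq> f ` pverts G" by (simp add: dominating_def)
    then obtain C where C: "C \<subseteq> pverts G" "D = f ` C" by (rule subset_imageE)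
    with D dominating_map_graph[OF w i C(1)] c[OF C(1)]
    show "n \<in> {card D | D. dominating G D}" by blast
  next
    assume "n \<in> {card D | D. dominating G D}"
    then obtain D where D: "n = card D" "dominating G D" by blast
    then have "D \<subseteq> pverts G" by (simp add: dominating_def)
    with D dominating_map_graph[OF w i this] c[OF this]
    show "n \<in> {card D | D. dominating (map_graph f G) D}" by (metis (mono_tags, lifting) mem_Collect_eq)
  qed
  then have "{card D | D. dominating (map_graph f G) D} = {card D | D. dominating G D}" by blast
  then show ?thesis by (simp only: domination_number_def)
qed

lemma cart_prod_map_graph:
  assumes "parcs G \<subseteq> pverts G \<times> pverts G" "parcs H \<subseteq> pverts H \<times> pverts H"
    and f: "inj_on f (pverts G)" and k: "inj_on k (pverts H)"
  shows "cart_prod (map_graph f G) (map_graph k H) = map_graph (map_prod f k) (cart_prod G H)"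
proof (rule pair_pre_digraph.equality)
  show "parcs (cart_prod (map_graph f G) (map_graph k H)) =
      parcs (map_graph (map_prod f k) (cart_prod G H))" (is "?L = ?R")
  proof (intro set_eqI iffI)
    fix e assume "e \<in> ?L"
    then consider (1) g h h' where "e = ((f g, k h), (f g, k h'))" "g \<in> pverts G" "(h, h') \<in> parcs H"
      | (2) g g' h where "e = ((f g, k h), (f g', k h))" "h \<in> pverts H" "(g, g') \<in> parcs G"
      by (auto simp: cart_prod_def)
    then show "e \<in> ?R"
    proof cases
      case 1
      then have "((g, h), (g, h')) \<in> parcs (cart_prod G H)" by (simp add: parcs_cart_prod_iff)
      from imageI[OF this, of "map_prod (map_prod f k) (map_prod f k)"] 1 show ?thesis by simp
    next
      case 2
      then have "((g, h), (g', h)) \<in> parcs (cart_prod G H)" by (simp add: parcs_cart_prod_iff)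
      from imageI[OF this, of "map_prod (map_prod f k) (map_prod f k)"] 2 show ?thesis by simp
    qed
  next
    fix e assume "e \<in> ?R"
    then obtain g h g' h' where e: "e = ((f g, k h), (f g', k h'))"
      and gh: "((g, h), (g', h')) \<in> parcs (cart_prod G H)" by auto
    from gh consider "g = g'" "g \<in> pverts G" "(h, h') \<in> parcs H"
      | "h = h'" "h \<in> pverts H" "(g, g') \<in> parcs G"
      by (auto simp: parcs_cart_prod_iff)
    then show "e \<in> ?L"
    proof cases
      case 1
      from imageI[OF 1(3), of "map_prod k k"] 1 e show ?thesis
        by (simp add: parcs_cart_prod_iff)
    next
      case 2
      from imageI[OF 2(3), of "map_prod f f"] 2 e show ?thesis
        by (simp add: parcs_cart_prod_iff)
    qed
  qed
qed (auto simp: cart_prod_def)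

lemma vizing_conjectureD:
  fixes G :: "'a pair_pre_digraph" and H :: "'b pair_pre_digraph"
  assumes V: vizing_conjecture and G: "pair_graph G" and H: "pair_graph H"
  shows "domination_number G * domination_number H \<le> domination_number (cart_prod G H)"
proof -
  obtain f :: "'a \<Rightarrow> nat" where f: "inj_on f (pverts G)"
    using G finite_imp_inj_to_nat_seg unfolding pair_graph_iff by metis
  obtain k :: "'b \<Rightarrow> nat" where k: "inj_on k (pverts H)"
    using H finite_imp_inj_to_nat_seg unfolding pair_graph_iff by metis
  have fk: "inj_on (map_prod f k) (pverts (cart_prod G H))"
    using f k by (auto simp: cart_prod_def intro: map_prod_inj_on)
  have "domination_number (map_graph f G) * domination_number (map_graph k H)
      \<le> domination_number (cart_prod (map_graph f G) (map_graph k H))"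
    using V pair_graph_map_graph[OF G f] pair_graph_map_graph[OF H k]
    unfolding vizing_conjecture_def by blast
  moreover have "parcs (cart_prod G H) \<subseteq> pverts (cart_prod G H) \<times> pverts (cart_prod G H)"
    using pair_graph_cart_prod[OF G H] by (simp add: pair_graph_iff)
  ultimately show ?thesis
    using G H f k fk
    by (simp add: cart_prod_map_graph domination_number_map_graph pair_graph_iff)
qed

section \<open>Polynomials over a subfield of the reals\<close>

definition real_subfield :: "real set \<Rightarrow> bool" where
  "real_subfield K \<longleftrightarrow>
     0 \<in> K \<and> 1 \<in> K \<and>
     (\<forall>a \<in> K. \<forall>b \<in> K. a + b \<in> K \<and> a * b \<in> K) \<and>
     (\<forall>a \<in> K. - a \<in> K \<and> inverse a \<in> K)"

text \<open>The algebraic closure of \<open>K\<close>, realised inside the complex numbers.\<close>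

definition alg_closure_in_complex :: "real set \<Rightarrow> complex set" where
  "alg_closure_in_complex K =
     {z. \<exists>p :: real poly. p \<noteq> 0 \<and> (\<forall>i. coeff p i \<in> K) \<and> poly (map_poly of_real p) z = 0}"

text \<open>A monomial is a finitely supported map from variables to exponents.\<close>

type_synonym 'x rpoly = "('x \<Rightarrow>\<^sub>0 nat) \<Rightarrow>\<^sub>0 real"

definition var :: "'x \<Rightarrow> 'x rpoly" where
  "var v = Poly_Mapping.single (Poly_Mapping.single v 1) 1"

text \<open>The ring $K[X]$, for a set \<open>X\<close> of variables.\<close>

definition poly_ring_over :: "real set \<Rightarrow> 'x set \<Rightarrow> 'x rpoly set" where
  "poly_ring_over K X =
     {p. (\<forall>m. Poly_Mapping.lookup p m \<in> K) \<and>
         (\<forall>m \<in> Poly_Mapping.keys p. Poly_Mapping.keys m \<subseteq> X)}"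

definition eval_rpoly :: "('x \<Rightarrow> complex) \<Rightarrow> 'x rpoly \<Rightarrow> complex" where
  "eval_rpoly z p =
     (\<Sum>m \<in> Poly_Mapping.keys p. of_real (Poly_Mapping.lookup p m) *
        (\<Prod>v \<in> Poly_Mapping.keys m. z v ^ Poly_Mapping.lookup m v))"

text \<open>The ideal of $K[X]$ generated by \<open>S\<close>; the cofactors are taken from $K[X]$.\<close>

definition ideal_generated :: "real set \<Rightarrow> 'x set \<Rightarrow> 'x rpoly set \<Rightarrow> 'x rpoly set" where
  "ideal_generated K X S =
     {\<Sum>p \<in> F. q p * p | F q. finite F \<and> F \<subseteq> S \<and> (\<forall>p \<in> F. q p \<in> poly_ring_over K X)}"

text \<open>Points are extensional functions, so that a point is determined by its coordinates
  at the variables in \<open>X\<close>.\<close>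

definition variety :: "real set \<Rightarrow> 'x set \<Rightarrow> 'x rpoly set \<Rightarrow> ('x \<Rightarrow> complex) set" where
  "variety K X I = {z \<in> X \<rightarrow>\<^sub>E alg_closure_in_complex K. \<forall>p \<in> I. eval_rpoly z p = 0}"

section \<open>The ideal and the polynomial associated with Vizing's conjecture\<close>

text \<open>\<open>Edge {u, v}\<close> is the index of $e_{uv} = e_{vu}$, and \<open>Prod g h\<close> that of $x_{gh}$.\<close>

datatype 'v viz_var = Edge "'v set" | Prod 'v 'v

definition viz_vars :: "'v set \<Rightarrow> 'v set \<Rightarrow> 'v viz_var set" where
  "viz_vars VG VH =
     {Edge {g, g'} | g g'. g \<in> VG \<and> g' \<in> VG \<and> g \<noteq> g'} \<union>
     {Edge {h, h'} | h h'. h \<in> VH \<and> h' \<in> VH \<and> h \<noteq> h'} \<union>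
     {Prod g h | g h. g \<in> VG \<and> h \<in> VH}"

definition e_var :: "'v \<Rightarrow> 'v \<Rightarrow> 'v viz_var rpoly" where
  "e_var u v = var (Edge {u, v})"

definition x_var :: "'v \<Rightarrow> 'v \<Rightarrow> 'v viz_var rpoly" where
  "x_var g h = var (Prod g h)"

definition graph_generators :: "'v set \<Rightarrow> 'v set \<Rightarrow> nat \<Rightarrow> 'v viz_var rpoly set" where
  "graph_generators V D k =
     {e_var g g' ^ 2 - e_var g g' | g g'. g \<in> V \<and> g' \<in> V \<and> g \<noteq> g'} \<union>
     {\<Prod>g' \<in> D. 1 - e_var g g' | g. g \<in> V - D} \<union>
     {\<Prod>g' \<in> V - S. \<Sum>g \<in> S. e_var g g' | S. S \<subseteq> V \<and> card S = k - 1}"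

definition product_generators :: "'v set \<Rightarrow> 'v set \<Rightarrow> 'v viz_var rpoly set" where
  "product_generators VG VH =
     {x_var g h ^ 2 - x_var g h | g h. g \<in> VG \<and> h \<in> VH} \<union>
     {(1 - x_var g h) *
      (\<Prod>g' \<in> VG - {g}. 1 - e_var g g' * x_var g' h) *
      (\<Prod>h' \<in> VH - {h}. 1 - e_var h h' * x_var g h') | g h. g \<in> VG \<and> h \<in> VH}"

definition I_viz ::
    "real set \<Rightarrow> 'v set \<Rightarrow> 'v set \<Rightarrow> nat \<Rightarrow> 'v set \<Rightarrow> 'v set \<Rightarrow> nat \<Rightarrow> 'v viz_var rpoly set" where
  "I_viz K VG DG kG VH DH kH =
     ideal_generated K (viz_vars VG VH)
       (graph_generators VG DG kG \<union> graph_generators VH DH kH \<union> product_generators VG VH)"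

definition f_viz :: "'v set \<Rightarrow> nat \<Rightarrow> 'v set \<Rightarrow> nat \<Rightarrow> 'v viz_var rpoly" where
  "f_viz VG kG VH kH = (\<Sum>g \<in> VG. \<Sum>h \<in> VH. x_var g h) - of_nat (kG * kH)"

text \<open>The admissible choices of the vertex sets and of their distinguished subsets.\<close>

definition viz_setting ::
    "nat \<Rightarrow> nat \<Rightarrow> nat \<Rightarrow> nat \<Rightarrow> 'v set \<Rightarrow> 'v set \<Rightarrow> 'v set \<Rightarrow> 'v set \<Rightarrow> bool" where
  "viz_setting nG kG nH kH VG DG VH DH \<longleftrightarrow>
     finite VG \<and> card VG = nG \<and> DG \<subseteq> VG \<and> card DG = kG \<and>
     finite VH \<and> card VH = nH \<and> DH \<subseteq> VH \<and> card DH = kH \<and>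
     VG \<inter> VH = {}"

end

theory Submission
  imports Defs
begin

text \<open>The idempotency generators force every coordinate of a zero \<open>z\<close> to be 0 or 1, so \<open>z\<close>
  is nothing but a pair of graphs together with a set of vertices of their Cartesian product.
  Since sums of 0/1 values vanish only termwise, the remaining generators then say that the
  graphs have domination numbers \<open>kG\<close> and \<open>kH\<close>, attained at \<open>DG\<close> and \<open>DH\<close>, and that the set is
  dominating in the product.  At such a point $f_{\mathrm{viz}}$ is the size of this set minus
  \<open>kG * kH\<close>.  Conversely, any two graphs can be relabelled so that minimum dominating sets land on
  \<open>DG\<close> and \<open>DH\<close>; together with a minimum dominating set of the product they form a zero.\<close>

section \<open>Evaluation of polynomials\<close>

definition eval_monom :: "('x \<Rightarrow> complex) \<Rightarrow> ('x \<Rightarrow>\<^sub>0 nat) \<Rightarrow> complex" where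
  "eval_monom z m = (\<Prod>v \<in> Poly_Mapping.keys m. z v ^ Poly_Mapping.lookup m v)"

text \<open>Variables outside the support have exponent 0 and contribute the factor 1, so two
  monomials can be evaluated over a common index set.\<close>

lemma eval_monom_superset:
  assumes "finite A" "Poly_Mapping.keys m \<subseteq> A"
  shows "eval_monom z m = (\<Prod>v \<in> A. z v ^ Poly_Mapping.lookup m v)"
  unfolding eval_monom_def using assms
  by (intro prod.mono_neutral_left) (auto simp: in_keys_iff)

lemma eval_monom_add: "eval_monom z (m + n) = eval_monom z m * eval_monom z n"
proof -
  let ?A = "Poly_Mapping.keys m \<union> Poly_Mapping.keys n"
  have "eval_monom z (m + n) = (\<Prod>v \<in> ?A. z v ^ Poly_Mapping.lookup (m + n) v)"
    using Poly_Mapping.keys_add[of m n] by (intro eval_monom_superset) auto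
  also have "\<dots> = eval_monom z m * eval_monom z n"
    by (simp add: eval_monom_superset[of ?A m] eval_monom_superset[of ?A n]
        lookup_add power_add prod.distrib)
  finally show ?thesis .
qed

lemma eval_rpoly_superset:
  assumes "finite A" "Poly_Mapping.keys p \<subseteq> A"
  shows "eval_rpoly z p = (\<Sum>m \<in> A. of_real (Poly_Mapping.lookup p m) * eval_monom z m)"
  unfolding eval_rpoly_def eval_monom_def[symmetric] using assms
  by (intro sum.mono_neutral_left) (auto simp: in_keys_iff)

lemma eval_rpoly_zero [simp]: "eval_rpoly z 0 = 0"
  by (simp add: eval_rpoly_def)

lemma eval_rpoly_single [simp]:
  "eval_rpoly z (Poly_Mapping.single m a) = of_real a * eval_monom z m"
  by (subst eval_rpoly_superset[of "{m}"]) auto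

lemma eval_rpoly_add [simp]: "eval_rpoly z (p + q) = eval_rpoly z p + eval_rpoly z q"
proof -
  let ?A = "Poly_Mapping.keys p \<union> Poly_Mapping.keys q"
  have "eval_rpoly z (p + q) =
      (\<Sum>m \<in> ?A. of_real (Poly_Mapping.lookup (p + q) m) * eval_monom z m)"
    using Poly_Mapping.keys_add[of p q] by (intro eval_rpoly_superset) auto
  also have "\<dots> = eval_rpoly z p + eval_rpoly z q"
    by (simp add: eval_rpoly_superset[of ?A p] eval_rpoly_superset[of ?A q]
        lookup_add distrib_right sum.distrib)
  finally show ?thesis .
qed

lemma eval_rpoly_uminus [simp]: "eval_rpoly z (- p) = - eval_rpoly z p"
  by (metis add.right_inverse add_eq_0_iff eval_rpoly_add eval_rpoly_zero)

lemma eval_rpoly_diff [simp]: "eval_rpoly z (p - q) = eval_rpoly z p - eval_rpoly z q"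
  by (metis eval_rpoly_add eval_rpoly_uminus uminus_add_conv_diff add.commute)

lemma eval_rpoly_sum [simp]: "eval_rpoly z (\<Sum>i \<in> A. p i) = (\<Sum>i \<in> A. eval_rpoly z (p i))"
  by (induction A rule: infinite_finite_induct) auto

lemma poly_mapping_eq_sum_single:
  "p = (\<Sum>m \<in> Poly_Mapping.keys p. Poly_Mapping.single m (Poly_Mapping.lookup p m))"
proof (rule poly_mapping_eqI)
  fix k
  have "Poly_Mapping.lookup (\<Sum>m \<in> Poly_Mapping.keys p. Poly_Mapping.single m (Poly_Mapping.lookup p m)) k
      = (\<Sum>m \<in> Poly_Mapping.keys p. if m = k then Poly_Mapping.lookup p m else 0)"
    by (auto simp: lookup_sum lookup_single when_def intro!: sum.cong)
  also have "\<dots> = Poly_Mapping.lookup p k"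
    by (simp add: in_keys_iff)
  finally show "Poly_Mapping.lookup p k = Poly_Mapping.lookup
      (\<Sum>m \<in> Poly_Mapping.keys p. Poly_Mapping.single m (Poly_Mapping.lookup p m)) k" ..
qed

text \<open>Multiplication of poly mappings is a convolution; writing both factors as sums of single
  terms reduces the claim by bilinearity to \<open>mult_single\<close> and
  \<open>eval_monom_add\<close>.\<close>

lemma eval_rpoly_mult [simp]: "eval_rpoly z (p * q) = eval_rpoly z p * eval_rpoly z q"
proof -
  have "eval_rpoly z
      ((\<Sum>m \<in> Poly_Mapping.keys p. Poly_Mapping.single m (Poly_Mapping.lookup p m)) *
       (\<Sum>n \<in> Poly_Mapping.keys q. Poly_Mapping.single n (Poly_Mapping.lookup q n))) =
     eval_rpoly z (\<Sum>m \<in> Poly_Mapping.keys p. Poly_Mapping.single m (Poly_Mapping.lookup p m)) *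
     eval_rpoly z (\<Sum>n \<in> Poly_Mapping.keys q. Poly_Mapping.single n (Poly_Mapping.lookup q n))"
    by (simp add: sum_product mult_single eval_monom_add mult_ac)
  then show ?thesis by (simp only: poly_mapping_eq_sum_single[symmetric])
qed

lemma eval_rpoly_one [simp]: "eval_rpoly z 1 = 1"
  by (simp add: eval_monom_def flip: single_one)

lemma eval_rpoly_of_nat [simp]: "eval_rpoly z (of_nat n) = of_nat n"
  by (induction n) auto

lemma eval_rpoly_power [simp]: "eval_rpoly z (p ^ n) = eval_rpoly z p ^ n"
  by (induction n) auto

lemma eval_rpoly_prod [simp]: "eval_rpoly z (\<Prod>i \<in> A. p i) = (\<Prod>i \<in> A. eval_rpoly z (p i))"
  by (induction A rule: infinite_finite_induct) auto

lemma eval_rpoly_var [simp]: "eval_rpoly z (var v) = z v"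
  by (simp add: var_def eval_monom_def)

section \<open>Varieties of generated ideals and their admissible coordinates\<close>

text \<open>Each generator lies in the ideal with cofactor 1, and a combination of generators
  vanishes wherever they all do; hence only the generators matter from here on.\<close>

lemma variety_ideal_generated:
  assumes "real_subfield K"
  shows "variety K X (ideal_generated K X S) =
    {z \<in> X \<rightarrow>\<^sub>E alg_closure_in_complex K. \<forall>p \<in> S. eval_rpoly z p = 0}"
proof -
  have one: "1 \<in> poly_ring_over K X"
    using assms by (auto simp: poly_ring_over_def real_subfield_def lookup_one when_def)
  have "p \<in> ideal_generated K X S" if "p \<in> S" for p
    unfolding ideal_generated_def using that one
    by (intro CollectI exI[of _ "{p}"] exI[of _ "\<lambda>_. 1"]) auto
  moreover have "eval_rpoly z p = 0"
    if S: "\<forall>p \<in> S. eval_rpoly z p = 0" and p: "p \<in> ideal_generated K X S" for z p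
  proof -
    obtain F q where "F \<subseteq> S" and p_eq: "p = (\<Sum>f \<in> F. q f * f)"
      using p by (auto simp: ideal_generated_def)
    then have "(\<Sum>f \<in> F. eval_rpoly z (q f) * eval_rpoly z f) = 0"
      using S by (intro sum.neutral ballI) auto
    then show ?thesis by (simp add: p_eq)
  qed
  ultimately show ?thesis by (auto simp: variety_def)
qed

text \<open>Roots of X and X - 1. This admits every 0/1 point as a candidate for the
  variety.\<close>

lemma zero_one_in_alg_closure:
  assumes "real_subfield K"
  shows "0 \<in> alg_closure_in_complex K" "1 \<in> alg_closure_in_complex K"
proof -
  have K: "0 \<in> K" "1 \<in> K" "- 1 \<in> K" using assms by (auto simp: real_subfield_def)
  show "0 \<in> alg_closure_in_complex K"
    unfolding alg_closure_in_complex_def using K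
    by (intro CollectI exI[of _ "[:0, 1:]"]) (auto simp: coeff_pCons map_poly_pCons split: nat.split)
  show "1 \<in> alg_closure_in_complex K"
    unfolding alg_closure_in_complex_def using K
    by (intro CollectI exI[of _ "[:- 1, 1:]"]) (auto simp: coeff_pCons map_poly_pCons split: nat.split)
qed

section \<open>The domination number\<close>

lemma dominating_mono:
  "dominating G D \<Longrightarrow> D \<subseteq> E \<Longrightarrow> E \<subseteq> pverts G \<Longrightarrow> dominating G E"
  unfolding dominating_def by blast

lemma finite_dominating:
  assumes "finite (pverts G)"
  shows "finite {card D | D. dominating G D}"
proof -
  have "{card D | D. dominating G D} \<subseteq> card ` Pow (pverts G)"
    by (auto simp: dominating_def)
  with assms show ?thesis by (meson finite_Pow_iff finite_imageI finite_subset)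
qed

lemma domination_number_le:
  assumes "finite (pverts G)" "dominating G D"
  shows "domination_number G \<le> card D"
  unfolding domination_number_def using assms finite_dominating
  by (intro Min_le) auto

lemma domination_number_attained:
  assumes "finite (pverts G)"
  obtains D where "dominating G D" "card D = domination_number G"
proof -
  have "dominating G (pverts G)" by (simp add: dominating_def)
  then have "domination_number G \<in> {card D | D. dominating G D}"
    unfolding domination_number_def using finite_dominating[OF assms] by (intro Min_in) auto
  with that show ?thesis by auto
qed

text \<open>A dominating set with fewer than \<open>k\<close> vertices can be padded to one with
  exactly \<open>k - 1\<close>, so testing that single size, as the third generator family does,
  rules out all smaller ones. Positivity of \<open>k\<close> keeps the truncated
  \<open>k - 1\<close> below \<open>k\<close>.\<close>

lemma domination_number_eq_iff:
  assumes fin: "finite (pverts G)" and D: "dominating G D" "card D = k" and k: "0 < k"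
  shows "domination_number G = k \<longleftrightarrow>
    (\<forall>S \<subseteq> pverts G. card S = k - 1 \<longrightarrow> \<not> dominating G S)"
proof
  assume "domination_number G = k"
  with k show "\<forall>S \<subseteq> pverts G. card S = k - 1 \<longrightarrow> \<not> dominating G S"
    using domination_number_le[OF fin] by fastforce
next
  assume *: "\<forall>S \<subseteq> pverts G. card S = k - 1 \<longrightarrow> \<not> dominating G S"
  obtain C where C: "dominating G C" "card C = domination_number G"
    using domination_number_attained[OF fin] .
  have sub: "C \<subseteq> pverts G" "D \<subseteq> pverts G" using C D by (auto simp: dominating_def)
  \<comment> \<open>This bound leaves room for the padding inside the vertex set.\<close>
  have "k \<le> card (pverts G)" using sub D fin by (metis card_mono)
  have "\<not> card C \<le> k - 1"
  proof
    assume "card C \<le> k - 1"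
    then obtain S where "C \<subseteq> S" "S \<subseteq> pverts G" "card S = k - 1"
      using exists_subset_between[of C "k - 1" "pverts G"] sub fin \<open>k \<le> card (pverts G)\<close>
      by (meson diff_le_self order_trans)
    with * dominating_mono[OF C(1)] show False by blast
  qed
  moreover have "domination_number G \<le> k" using domination_number_le[OF fin D(1)] D(2) by simp
  ultimately show "domination_number G = k" using C(2) by simp
qed

lemma cart_prod_verts [simp]: "pverts (cart_prod G H) = pverts G \<times> pverts H"
  by (simp add: cart_prod_def)

section \<open>The zeros of the Vizing ideal\<close>

text \<open>Meaningful for every complex point, before its coordinates are known to be 0 or 1. The
  condition \<open>u \<noteq> v\<close> excludes the singleton \<open>Edge {u}\<close>, which is not
  a variable.\<close>

definition point_graph :: "('v viz_var \<Rightarrow> complex) \<Rightarrow> 'v set \<Rightarrow> 'v pair_pre_digraph" where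
  "point_graph z V =
     \<lparr> pverts = V, parcs = {(u, v). u \<in> V \<and> v \<in> V \<and> u \<noteq> v \<and> z (Edge {u, v}) = 1} \<rparr>"

definition point_set :: "('v viz_var \<Rightarrow> complex) \<Rightarrow> 'v set \<Rightarrow> 'v set \<Rightarrow> ('v \<times> 'v) set" where
  "point_set z VG VH = {(g, h). g \<in> VG \<and> h \<in> VH \<and> z (Prod g h) = 1}"

lemma verts_point_graph [simp]: "pverts (point_graph z V) = V"
  by (simp add: point_graph_def)

lemma arcs_point_graph [simp]:
  "(u, v) \<in> parcs (point_graph z V) \<longleftrightarrow>
     u \<in> V \<and> v \<in> V \<and> u \<noteq> v \<and> z (Edge {u, v}) = 1"
  by (simp add: point_graph_def)

lemma pair_graph_point_graph: "finite V \<Longrightarrow> pair_graph (point_graph z V)"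
  by (auto simp: pair_graph_iff irrefl_def insert_commute intro: symI)

text \<open>The complex 0/1 terms are identified through \<open>of_real\<close> with nonnegative
  reals, where a finite sum vanishes only if each term does.\<close>

lemma sum_zero_one_eq_0_iff:
  fixes c :: "'a \<Rightarrow> complex"
  assumes "finite A" "\<And>a. a \<in> A \<Longrightarrow> c a = 0 \<or> c a = 1"
  shows "sum c A = 0 \<longleftrightarrow> (\<forall>a \<in> A. c a \<noteq> 1)"
proof -
  have "sum c A = of_real (\<Sum>a \<in> A. if c a = 1 then 1 else 0)"
    unfolding of_real_sum using assms(2) by (intro sum.cong) auto
  also have "\<dots> = 0 \<longleftrightarrow> (\<forall>a \<in> A. c a \<noteq> 1)"
    using assms(1) unfolding of_real_eq_0_iff by (subst sum_nonneg_eq_0_iff) auto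
  finally show ?thesis .
qed

lemma graph_generators_vanish_iff:
  assumes V: "finite V" and D: "D \<subseteq> V" "card D = k" and k: "0 < k"
  shows "(\<forall>p \<in> graph_generators V D k. eval_rpoly z p = 0) \<longleftrightarrow>
    (\<forall>u \<in> V. \<forall>v \<in> V. u \<noteq> v \<longrightarrow> z (Edge {u, v}) \<in> {0, 1}) \<and>
    dominating (point_graph z V) D \<and> domination_number (point_graph z V) = k"
proof -
  let ?G = "point_graph z V"
  have fin: "finite A" if "A \<subseteq> V" for A using that V by (rule finite_subset)
  have bool: "(\<forall>g \<in> V. \<forall>g' \<in> V. g \<noteq> g' \<longrightarrow> eval_rpoly z (e_var g g' ^ 2 - e_var g g') = 0) \<longleftrightarrow>
      (\<forall>u \<in> V. \<forall>v \<in> V. u \<noteq> v \<longrightarrow> z (Edge {u, v}) \<in> {0, 1})"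
    by (simp add: e_var_def power2_eq_square)
  \<comment> \<open>A product vanishes iff some factor \<open>1 - e\<close> does, that is, iff
    \<open>g\<close> has an edge into \<open>D\<close>; since \<open>g\<close> lies outside
    \<open>D\<close>, the endpoints are distinct.\<close>
  have dom: "(\<forall>g \<in> V - D. eval_rpoly z (\<Prod>g' \<in> D. 1 - e_var g g') = 0) \<longleftrightarrow> dominating ?G D"
  proof -
    have "eval_rpoly z (\<Prod>g' \<in> D. 1 - e_var g g') = 0 \<longleftrightarrow> (\<exists>d \<in> D. (g, d) \<in> parcs ?G)"
      if "g \<in> V - D" for g
      using that D fin[OF D(1)] by (auto simp: e_var_def)
    with D(1) show ?thesis by (simp add: dominating_def)
  qed
  \<comment> \<open>The product vanishes iff some vertex \<open>g'\<close> outside \<open>S\<close>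
    has inner sum 0, meaning no neighbour in \<open>S\<close>. The 0/1 assumption prevents
    cancellation in these sums.\<close>
  have min: "(\<forall>S. S \<subseteq> V \<and> card S = k - 1 \<longrightarrow>
        eval_rpoly z (\<Prod>g' \<in> V - S. \<Sum>g \<in> S. e_var g g') = 0) \<longleftrightarrow>
      (\<forall>S \<subseteq> V. card S = k - 1 \<longrightarrow> \<not> dominating ?G S)"
    if edges: "\<forall>u \<in> V. \<forall>v \<in> V. u \<noteq> v \<longrightarrow> z (Edge {u, v}) \<in> {0, 1}"
  proof -
    have "eval_rpoly z (\<Prod>g' \<in> V - S. \<Sum>g \<in> S. e_var g g') = 0 \<longleftrightarrow> \<not> dominating ?G S"
      if S: "S \<subseteq> V" for S
    proof -
      have "(\<Sum>g \<in> S. z (Edge {g, g'})) = 0 \<longleftrightarrow> (\<forall>g \<in> S. (g', g) \<notin> parcs ?G)"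
        if "g' \<in> V - S" for g'
      proof -
        have "(\<Sum>g \<in> S. z (Edge {g, g'})) = 0 \<longleftrightarrow> (\<forall>g \<in> S. z (Edge {g, g'}) \<noteq> 1)"
          using edges S that by (intro sum_zero_one_eq_0_iff fin) auto
        moreover have "g' \<noteq> g \<and> g \<in> V \<and> g' \<in> V" if "g \<in> S" for g
          using S that \<open>g' \<in> V - S\<close> by auto
        ultimately show ?thesis by (simp add: insert_commute cong: ball_cong)
      qed
      with S V show ?thesis by (simp add: e_var_def dominating_def)
    qed
    then show ?thesis by auto
  qed
  have "(\<forall>p \<in> graph_generators V D k. eval_rpoly z p = 0) \<longleftrightarrow>
      (\<forall>g \<in> V. \<forall>g' \<in> V. g \<noteq> g' \<longrightarrow> eval_rpoly z (e_var g g' ^ 2 - e_var g g') = 0) \<and>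
      (\<forall>g \<in> V - D. eval_rpoly z (\<Prod>g' \<in> D. 1 - e_var g g') = 0) \<and>
      (\<forall>S. S \<subseteq> V \<and> card S = k - 1 \<longrightarrow>
        eval_rpoly z (\<Prod>g' \<in> V - S. \<Sum>g \<in> S. e_var g g') = 0)"
    unfolding graph_generators_def by blast
  \<comment> \<open>\<open>min\<close> is available only under the first conjunct, so the
    conjunction is rewritten as a whole.\<close>
  also have "\<dots> \<longleftrightarrow> (\<forall>u \<in> V. \<forall>v \<in> V. u \<noteq> v \<longrightarrow> z (Edge {u, v}) \<in> {0, 1}) \<and>
      dominating ?G D \<and> (\<forall>S \<subseteq> V. card S = k - 1 \<longrightarrow> \<not> dominating ?G S)"
    unfolding bool dom using min by argo
  also have "\<dots> \<longleftrightarrow> (\<forall>u \<in> V. \<forall>v \<in> V. u \<noteq> v \<longrightarrow> z (Edge {u, v}) \<in> {0, 1}) \<and>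
      dominating ?G D \<and> domination_number ?G = k"
    using domination_number_eq_iff[of ?G D k, unfolded verts_point_graph] V D(2) k by metis
  finally show ?thesis .
qed

text \<open>The three factors of the generator at \<open>(g, h)\<close> stand for the three ways of
  being dominated: lying in the set, having a neighbour in it along the first graph, or along the
  second.\<close>

lemma product_generators_vanish_iff:
  assumes V: "finite VG" "finite VH"
    and G: "\<And>u v. u \<in> VG \<Longrightarrow> v \<in> VG \<Longrightarrow> u \<noteq> v \<Longrightarrow> z (Edge {u, v}) \<in> {0, 1}"
    and H: "\<And>u v. u \<in> VH \<Longrightarrow> v \<in> VH \<Longrightarrow> u \<noteq> v \<Longrightarrow> z (Edge {u, v}) \<in> {0, 1}"
  shows "(\<forall>p \<in> product_generators VG VH. eval_rpoly z p = 0) \<longleftrightarrow>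
    (\<forall>g \<in> VG. \<forall>h \<in> VH. z (Prod g h) \<in> {0, 1}) \<and>
    dominating (cart_prod (point_graph z VG) (point_graph z VH)) (point_set z VG VH)"
proof -
  let ?GH = "cart_prod (point_graph z VG) (point_graph z VH)"
  let ?p = "\<lambda>g h. (1 - x_var g h) *
      (\<Prod>g' \<in> VG - {g}. 1 - e_var g g' * x_var g' h) *
      (\<Prod>h' \<in> VH - {h}. 1 - e_var h h' * x_var g h')"
  have bool: "(\<forall>g \<in> VG. \<forall>h \<in> VH. eval_rpoly z (x_var g h ^ 2 - x_var g h) = 0) \<longleftrightarrow>
      (\<forall>g \<in> VG. \<forall>h \<in> VH. z (Prod g h) \<in> {0, 1})"
    by (simp add: x_var_def power2_eq_square)
  have dom: "(\<forall>g \<in> VG. \<forall>h \<in> VH. eval_rpoly z (?p g h) = 0) \<longleftrightarrow>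
      dominating ?GH (point_set z VG VH)"
    if x: "\<forall>g \<in> VG. \<forall>h \<in> VH. z (Prod g h) \<in> {0, 1}"
  proof -
    have "eval_rpoly z (?p g h) = 0 \<longleftrightarrow>
        (g, h) \<in> point_set z VG VH \<or> (\<exists>d \<in> point_set z VG VH. ((g, h), d) \<in> parcs ?GH)"
      if gh: "g \<in> VG" "h \<in> VH" for g h
    proof -
      \<comment> \<open>With both values in \<open>{0, 1}\<close>, a product equal to 1 forces both
        to be 1; arbitrary complex values could be mutually inverse.\<close>
      have 1: "1 - z (Edge {g, g'}) * z (Prod g' h) = 0 \<longleftrightarrow>
          z (Edge {g, g'}) = 1 \<and> z (Prod g' h) = 1" if "g' \<in> VG - {g}" for g'
        using that gh x G[of g g'] by auto
      have 2: "1 - z (Edge {h, h'}) * z (Prod g h') = 0 \<longleftrightarrow>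
          z (Edge {h, h'}) = 1 \<and> z (Prod g h') = 1" if "h' \<in> VH - {h}" for h'
        using that gh x H[of h h'] by auto
      have "eval_rpoly z (?p g h) = 0 \<longleftrightarrow> z (Prod g h) = 1 \<or>
          (\<exists>g' \<in> VG - {g}. z (Edge {g, g'}) = 1 \<and> z (Prod g' h) = 1) \<or>
          (\<exists>h' \<in> VH - {h}. z (Edge {h, h'}) = 1 \<and> z (Prod g h') = 1)"
        using V 1 2 by (auto simp: e_var_def x_var_def)
      also have "\<dots> \<longleftrightarrow> (g, h) \<in> point_set z VG VH \<or>
          (\<exists>d \<in> point_set z VG VH. ((g, h), d) \<in> parcs ?GH)"
        using gh by (auto simp: point_set_def parcs_cart_prod_iff)
      finally show ?thesis .
    qed
    then have "(\<forall>g \<in> VG. \<forall>h \<in> VH. eval_rpoly z (?p g h) = 0) \<longleftrightarrow>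
        (\<forall>gh \<in> VG \<times> VH - point_set z VG VH. \<exists>d \<in> point_set z VG VH. (gh, d) \<in> parcs ?GH)"
      by blast
    moreover have "point_set z VG VH \<subseteq> VG \<times> VH" by (auto simp: point_set_def)
    ultimately show ?thesis by (simp add: dominating_def)
  qed
  have "(\<forall>p \<in> product_generators VG VH. eval_rpoly z p = 0) \<longleftrightarrow>
      (\<forall>g \<in> VG. \<forall>h \<in> VH. eval_rpoly z (x_var g h ^ 2 - x_var g h) = 0) \<and>
      (\<forall>g \<in> VG. \<forall>h \<in> VH. eval_rpoly z (?p g h) = 0)"
    unfolding product_generators_def by blast
  then show ?thesis unfolding bool using dom by argo
qed

text \<open>Breaks a condition on all coordinates into the shapes in which the generator lemmas
  deliver it.\<close>

lemma ball_viz_vars: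
  "(\<forall>x \<in> viz_vars VG VH. P x) \<longleftrightarrow>
     (\<forall>u \<in> VG. \<forall>v \<in> VG. u \<noteq> v \<longrightarrow> P (Edge {u, v})) \<and>
     (\<forall>u \<in> VH. \<forall>v \<in> VH. u \<noteq> v \<longrightarrow> P (Edge {u, v})) \<and>
     (\<forall>g \<in> VG. \<forall>h \<in> VH. P (Prod g h))"
  (is "?L \<longleftrightarrow> ?R")
proof
  assume L: ?L
  have "Edge {u, v} \<in> viz_vars VG VH" if "u \<in> VG" "v \<in> VG" "u \<noteq> v" for u v
    using that by (auto simp: viz_vars_def)
  moreover have "Edge {u, v} \<in> viz_vars VG VH" if "u \<in> VH" "v \<in> VH" "u \<noteq> v" for u v
    using that by (auto simp: viz_vars_def)
  moreover have "Prod g h \<in> viz_vars VG VH" if "g \<in> VG" "h \<in> VH" for g h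
    using that by (auto simp: viz_vars_def)
  ultimately show ?R using L by simp
next
  assume R: ?R
  show ?L
  proof
    fix x assume "x \<in> viz_vars VG VH"
    then consider u v where "x = Edge {u, v}" "u \<in> VG" "v \<in> VG" "u \<noteq> v"
      | u v where "x = Edge {u, v}" "u \<in> VH" "v \<in> VH" "u \<noteq> v"
      | g h where "x = Prod g h" "g \<in> VG" "h \<in> VH"
      by (auto simp: viz_vars_def)
    then show "P x" using R by cases simp_all
  qed
qed

text \<open>The dictionary between zeros and combinatorial data. The algebraic closure drops out:
  idempotency confines the coordinates to 0 and 1, which it contains.\<close>

lemma mem_variety_viz_iff:
  assumes K: "real_subfield K" and k: "0 < kG" "0 < kH"
    and s: "viz_setting nG kG nH kH VG DG VH DH"
  shows "z \<in> variety K (viz_vars VG VH) (I_viz K VG DG kG VH DH kH) \<longleftrightarrow>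
    z \<in> viz_vars VG VH \<rightarrow>\<^sub>E {0, 1} \<and>
    dominating (point_graph z VG) DG \<and> domination_number (point_graph z VG) = kG \<and>
    dominating (point_graph z VH) DH \<and> domination_number (point_graph z VH) = kH \<and>
    dominating (cart_prod (point_graph z VG) (point_graph z VH)) (point_set z VG VH)"
proof -
  have E: "z \<in> viz_vars VG VH \<rightarrow>\<^sub>E {0, 1} \<longleftrightarrow>
      z \<in> viz_vars VG VH \<rightarrow>\<^sub>E alg_closure_in_complex K \<and>
      (\<forall>u \<in> VG. \<forall>v \<in> VG. u \<noteq> v \<longrightarrow> z (Edge {u, v}) \<in> {0, 1}) \<and>
      (\<forall>u \<in> VH. \<forall>v \<in> VH. u \<noteq> v \<longrightarrow> z (Edge {u, v}) \<in> {0, 1}) \<and>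
      (\<forall>g \<in> VG. \<forall>h \<in> VH. z (Prod g h) \<in> {0, 1})"
  proof -
    have "z \<in> viz_vars VG VH \<rightarrow>\<^sub>E {0, 1} \<longleftrightarrow> z \<in> viz_vars VG VH \<rightarrow>\<^sub>E alg_closure_in_complex K \<and>
        (\<forall>x \<in> viz_vars VG VH. z x \<in> {0, 1})"
    proof -
      have "{0, 1} \<subseteq> alg_closure_in_complex K" by (simp add: zero_one_in_alg_closure[OF K])
      then show ?thesis unfolding PiE_iff by blast
    qed
    then show ?thesis unfolding ball_viz_vars .
  qed
  have "z \<in> variety K (viz_vars VG VH) (I_viz K VG DG kG VH DH kH) \<longleftrightarrow>
    z \<in> viz_vars VG VH \<rightarrow>\<^sub>E alg_closure_in_complex K \<and>
    (\<forall>p \<in> graph_generators VG DG kG. eval_rpoly z p = 0) \<and>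
    (\<forall>p \<in> graph_generators VH DH kH. eval_rpoly z p = 0) \<and>
    (\<forall>p \<in> product_generators VG VH. eval_rpoly z p = 0)"
    unfolding I_viz_def variety_ideal_generated[OF K] by auto
  also have "\<dots> \<longleftrightarrow> z \<in> viz_vars VG VH \<rightarrow>\<^sub>E {0, 1} \<and>
    dominating (point_graph z VG) DG \<and> domination_number (point_graph z VG) = kG \<and>
    dominating (point_graph z VH) DH \<and> domination_number (point_graph z VH) = kH \<and>
    dominating (cart_prod (point_graph z VG) (point_graph z VH)) (point_set z VG VH)"
  proof -
    have fG: "finite VG" "DG \<subseteq> VG" "card DG = kG" and fH: "finite VH" "DH \<subseteq> VH" "card DH = kH"
      using s by (auto simp: viz_setting_def)
    \<comment> \<open>The 0/1 edge values required here come from the generators of the two graphs,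
      so the product condition is translated only in their presence.\<close>
    have "(\<forall>p \<in> product_generators VG VH. eval_rpoly z p = 0) \<longleftrightarrow>
        (\<forall>g \<in> VG. \<forall>h \<in> VH. z (Prod g h) \<in> {0, 1}) \<and>
        dominating (cart_prod (point_graph z VG) (point_graph z VH)) (point_set z VG VH)"
      if "\<forall>u \<in> VG. \<forall>v \<in> VG. u \<noteq> v \<longrightarrow> z (Edge {u, v}) \<in> {0, 1}"
        "\<forall>u \<in> VH. \<forall>v \<in> VH. u \<noteq> v \<longrightarrow> z (Edge {u, v}) \<in> {0, 1}"
      using that by (intro product_generators_vanish_iff fG(1) fH(1)) auto
    then show ?thesis
      unfolding E graph_generators_vanish_iff[OF fG k(1)] graph_generators_vanish_iff[OF fH k(2)]
      by argo
  qed
  finally show ?thesis .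
qed

section \<open>The value of the objective polynomial at 0/1 points\<close>

lemma eval_f_viz:
  assumes "finite VG" "finite VH" "\<And>g h. g \<in> VG \<Longrightarrow> h \<in> VH \<Longrightarrow> z (Prod g h) \<in> {0, 1}"
  shows "eval_rpoly z (f_viz VG kG VH kH) =
    of_real (of_nat (card (point_set z VG VH)) - of_nat (kG * kH))"
proof -
  have "(\<Sum>g \<in> VG. \<Sum>h \<in> VH. z (Prod g h)) = (\<Sum>(g, h) \<in> VG \<times> VH. z (Prod g h))"
    by (simp add: sum.cartesian_product)
  also have "\<dots> = (\<Sum>gh \<in> VG \<times> VH. if gh \<in> point_set z VG VH then 1 else 0)"
    using assms(3) by (intro sum.cong) (auto simp: point_set_def)
  also have "\<dots> = of_nat (card (point_set z VG VH))"
  proof -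
    have "VG \<times> VH \<inter> point_set z VG VH = point_set z VG VH" by (auto simp: point_set_def)
    with assms show ?thesis by (simp add: sum.inter_restrict[symmetric])
  qed
  finally show ?thesis by (simp add: f_viz_def x_var_def)
qed

text \<open>The subtraction is taken in the reals before the embedding, so it is not truncated and
  its sign is exactly the comparison of two natural numbers.\<close>

lemma eval_f_viz_nonneg_iff:
  assumes "finite VG" "finite VH" "z \<in> viz_vars VG VH \<rightarrow>\<^sub>E {0, 1}"
  shows "eval_rpoly z (f_viz VG kG VH kH) \<in> \<real>\<^sub>\<ge>\<^sub>0 \<longleftrightarrow> kG * kH \<le> card (point_set z VG VH)"
proof -
  have x: "z (Prod g h) \<in> {0, 1}" if "g \<in> VG" "h \<in> VH" for g h
  proof (rule PiE_mem[OF assms(3)])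
    show "Prod g h \<in> viz_vars VG VH" using that by (auto simp: viz_vars_def)
  qed
  have "eval_rpoly z (f_viz VG kG VH kH) =
      of_real (of_nat (card (point_set z VG VH)) - of_nat (kG * kH))"
    using assms(1,2) x by (rule eval_f_viz)
  then show ?thesis
    by (simp only: nonneg_Reals_of_real_iff diff_ge_0_iff_ge of_nat_le_iff)
qed

section \<open>Zeros built from two graphs and a dominating set\<close>

text \<open>Encodes its arguments so that \<open>point_graph\<close> and \<open>point_set\<close>
  can recover them. One rule serves the edges of both graphs; \<open>restrict\<close> makes the
  point extensional, as \<open>variety\<close> demands.\<close>

definition viz_point ::
    "'v pair_pre_digraph \<Rightarrow> 'v pair_pre_digraph \<Rightarrow> ('v \<times> 'v) set \<Rightarrow> 'v viz_var \<Rightarrow> complex" where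
  "viz_point G H D = restrict
     (\<lambda>x. case x of
        Edge s \<Rightarrow> if \<exists>u v. s = {u, v} \<and> (u, v) \<in> parcs G \<union> parcs H then 1 else 0
      | Prod g h \<Rightarrow> if (g, h) \<in> D then 1 else 0)
     (viz_vars (pverts G) (pverts H))"

lemma viz_point_in_PiE: "viz_point G H D \<in> viz_vars (pverts G) (pverts H) \<rightarrow>\<^sub>E {0, 1}"
  by (auto simp: viz_point_def PiE_iff split: viz_var.split)

lemma point_set_viz_point:
  assumes "D \<subseteq> pverts G \<times> pverts H"
  shows "point_set (viz_point G H D) (pverts G) (pverts H) = D"
  using assms by (auto simp: point_set_def viz_point_def viz_vars_def)

text \<open>Disjointness keeps arcs of one graph from being read as arcs of the other; symmetry lets
  arcs be recovered from unordered pairs, and irreflexivity matches the exclusion of loops in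
  \<open>point_graph\<close>.\<close>

lemma point_graph_viz_point:
  assumes G: "pair_graph G" and H: "pair_graph H" and disj: "pverts G \<inter> pverts H = {}"
  shows "point_graph (viz_point G H D) (pverts G) = G"
    and "point_graph (viz_point G H D) (pverts H) = H"
proof -
  have g: "parcs G \<subseteq> pverts G \<times> pverts G" "sym (parcs G)" "irrefl (parcs G)"
    and h: "parcs H \<subseteq> pverts H \<times> pverts H" "sym (parcs H)" "irrefl (parcs H)"
    using G H by (auto simp: pair_graph_iff)
  have e: "viz_point G H D (Edge {u, v}) = (if (u, v) \<in> parcs G \<union> parcs H then 1 else 0)"
    if "u \<noteq> v" "u \<in> pverts G \<and> v \<in> pverts G \<or> u \<in> pverts H \<and> v \<in> pverts H" for u v
  proof -
    have "Edge {u, v} \<in> viz_vars (pverts G) (pverts H)"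
      using that unfolding viz_vars_def by blast
    moreover have "(\<exists>a b. {u, v} = {a, b} \<and> (a, b) \<in> parcs G \<union> parcs H) \<longleftrightarrow>
        (u, v) \<in> parcs G \<union> parcs H"
      using g(2) h(2) by (metis (no_types, lifting) Un_iff doubleton_eq_iff symD)
    ultimately show ?thesis by (simp add: viz_point_def)
  qed
  have "(u, v) \<in> parcs (point_graph (viz_point G H D) (pverts G)) \<longleftrightarrow> (u, v) \<in> parcs G" for u v
  proof (cases "u \<noteq> v \<and> u \<in> pverts G \<and> v \<in> pverts G")
    case True
    then have "(u, v) \<notin> parcs H" using h(1) disj by blast
    with True e[of u v] show ?thesis by simp
  next
    case False
    then have "(u, v) \<notin> parcs G" using g(1,3) by (auto simp: irrefl_def)
    with False show ?thesis by auto
  qed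
  then have "parcs (point_graph (viz_point G H D) (pverts G)) = parcs G"
    by (simp add: set_eq_iff)
  then show "point_graph (viz_point G H D) (pverts G) = G"
    by (intro pair_pre_digraph.equality) simp_all
  have "(u, v) \<in> parcs (point_graph (viz_point G H D) (pverts H)) \<longleftrightarrow> (u, v) \<in> parcs H" for u v
  proof (cases "u \<noteq> v \<and> u \<in> pverts H \<and> v \<in> pverts H")
    case True
    then have "(u, v) \<notin> parcs G" using g(1) disj by blast
    with True e[of u v] show ?thesis by simp
  next
    case False
    then have "(u, v) \<notin> parcs H" using h(1,3) by (auto simp: irrefl_def)
    with False show ?thesis by auto
  qed
  then have "parcs (point_graph (viz_point G H D) (pverts H)) = parcs H"
    by (simp add: set_eq_iff)
  then show "point_graph (viz_point G H D) (pverts H) = H"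
    by (intro pair_pre_digraph.equality) simp_all
qed

section \<open>Relabelling graphs onto prescribed vertex sets\<close>

text \<open>Glues a bijection from \<open>C\<close> to \<open>D\<close> with one between the
  complements, which have equal size.\<close>

lemma ex_bij_betw_mapping_subset:
  assumes "finite A" "finite B" "card A = card B" "C \<subseteq> A" "D \<subseteq> B" "card C = card D"
  obtains f where "bij_betw f A B" "f ` C = D"
proof -
  have fin: "finite C" "finite D" using assms by (auto intro: finite_subset)
  obtain f where f: "bij_betw f C D"
    using finite_same_card_bij[OF fin assms(6)] by blast
  have "card (A - C) = card (B - D)"
    using assms fin by (simp add: card_Diff_subset)
  then obtain g where g: "bij_betw g (A - C) (B - D)"
    using assms by (meson finite_Diff finite_same_card_bij)
  let ?h = "\<lambda>x. if x \<in> C then f x else g x"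
  have 1: "bij_betw ?h C D" using f bij_betw_cong[of C ?h f D] by simp
  have 2: "bij_betw ?h (A - C) (B - D)" using g bij_betw_cong[of "A - C" ?h g "B - D"] by simp
  have "bij_betw ?h (C \<union> (A - C)) (D \<union> (B - D))"
    using 1 2 by (rule bij_betw_combine) blast
  moreover have "C \<union> (A - C) = A" "D \<union> (B - D) = B" using assms by auto
  ultimately have "bij_betw ?h A B" by simp
  moreover have "?h ` C = D" using 1 by (rule bij_betw_imp_surj_on)
  ultimately show ?thesis by (rule that)
qed

text \<open>A minimum dominating set of \<open>G\<close> has the size of \<open>D\<close> and can be
  sent onto it, the remaining vertices going bijectively to the rest of \<open>V\<close>.\<close>

lemma transport_graph:
  assumes G: "pair_graph G" and V: "finite V" "card V = card (pverts G)"
    and D: "D \<subseteq> V" "card D = domination_number G"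
  obtains f where "bij_betw f (pverts G) V" "dominating (map_graph f G) D"
proof -
  have fin: "finite (pverts G)" and w: "parcs G \<subseteq> pverts G \<times> pverts G"
    using G by (auto simp: pair_graph_iff)
  obtain C where C: "dominating G C" "card C = domination_number G"
    using domination_number_attained[OF fin] .
  then have sub: "C \<subseteq> pverts G" by (simp add: dominating_def)
  have "card C = card D" using C D by simp
  then obtain f where f: "bij_betw f (pverts G) V" "f ` C = D"
    using ex_bij_betw_mapping_subset[OF fin V(1) V(2)[symmetric] sub D(1)] by blast
  then have "inj_on f (pverts G)" by (simp add: bij_betw_def)
  with dominating_map_graph[OF w _ sub] C(1) f that show ?thesis by blast
qed

text \<open>The vertex sets are an arbitrary choice, one for each admissible quadruple of
  parameters; as their sizes are unbounded, \<open>'v\<close> is infinite. Relabelling mediates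
  between these sets and the graphs on \<open>nat\<close> in
  \<open>vizing_conjecture\<close>.\<close>

theorem theorem3p10:
  fixes K :: "real set"
    and VG DG VH DH :: "nat \<Rightarrow> nat \<Rightarrow> nat \<Rightarrow> nat \<Rightarrow> 'v set"
  assumes "real_subfield K"
    and "\<And>nG kG nH kH. 0 < nG \<Longrightarrow> 0 < kG \<Longrightarrow> 0 < nH \<Longrightarrow> 0 < kH \<Longrightarrow> kG \<le> nG \<Longrightarrow> kH \<le> nH \<Longrightarrow>
           viz_setting nG kG nH kH
             (VG nG kG nH kH) (DG nG kG nH kH) (VH nG kG nH kH) (DH nG kG nH kH)"
  shows "vizing_conjecture \<longleftrightarrow>
    (\<forall>nG kG nH kH. 0 < nG \<longrightarrow> 0 < kG \<longrightarrow> 0 < nH \<longrightarrow> 0 < kH \<longrightarrow> kG \<le> nG \<longrightarrow> kH \<le> nH \<longrightarrow>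
       (\<forall>z \<in> variety K (viz_vars (VG nG kG nH kH) (VH nG kG nH kH))
               (I_viz K (VG nG kG nH kH) (DG nG kG nH kH) kG
                        (VH nG kG nH kH) (DH nG kG nH kH) kH).
          eval_rpoly z (f_viz (VG nG kG nH kH) kG (VH nG kG nH kH) kH) \<in> \<real>\<^sub>\<ge>\<^sub>0))"
proof
  assume viz: vizing_conjecture
  show "\<forall>nG kG nH kH. 0 < nG \<longrightarrow> 0 < kG \<longrightarrow> 0 < nH \<longrightarrow> 0 < kH \<longrightarrow> kG \<le> nG \<longrightarrow> kH \<le> nH \<longrightarrow>
       (\<forall>z \<in> variety K (viz_vars (VG nG kG nH kH) (VH nG kG nH kH))
               (I_viz K (VG nG kG nH kH) (DG nG kG nH kH) kG
                        (VH nG kG nH kH) (DH nG kG nH kH) kH).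
          eval_rpoly z (f_viz (VG nG kG nH kH) kG (VH nG kG nH kH) kH) \<in> \<real>\<^sub>\<ge>\<^sub>0)"
  proof (intro allI impI ballI)
    fix nG kG nH kH :: nat and z
    assume pos: "0 < nG" "0 < kG" "0 < nH" "0 < kH" "kG \<le> nG" "kH \<le> nH"
    let ?VG = "VG nG kG nH kH" and ?DG = "DG nG kG nH kH"
      and ?VH = "VH nG kG nH kH" and ?DH = "DH nG kG nH kH"
    assume z: "z \<in> variety K (viz_vars ?VG ?VH) (I_viz K ?VG ?DG kG ?VH ?DH kH)"
    have s: "viz_setting nG kG nH kH ?VG ?DG ?VH ?DH" using assms(2) pos .
    then have fin: "finite ?VG" "finite ?VH" by (auto simp: viz_setting_def)
    let ?G = "point_graph z ?VG" and ?H = "point_graph z ?VH"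
    from z[unfolded mem_variety_viz_iff[OF assms(1) pos(2,4) s]]
    have z01: "z \<in> viz_vars ?VG ?VH \<rightarrow>\<^sub>E {0, 1}"
      and dn: "domination_number ?G = kG" "domination_number ?H = kH"
      and dom: "dominating (cart_prod ?G ?H) (point_set z ?VG ?VH)"
      by blast+
    \<comment> \<open>The graphs read off from \<open>z\<close> have vertices in \<open>'v\<close>,
      hence the form of the conjecture for arbitrary vertex types.\<close>
    have "kG * kH \<le> domination_number (cart_prod ?G ?H)"
      using vizing_conjectureD[OF viz pair_graph_point_graph[OF fin(1), of z]
          pair_graph_point_graph[OF fin(2), of z]] dn by simp
    \<comment> \<open>The set encoded by \<open>z\<close> dominates the product but need not be
      minimum.\<close>
    also have "\<dots> \<le> card (point_set z ?VG ?VH)"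
      using dom fin by (intro domination_number_le) auto
    finally show "eval_rpoly z (f_viz ?VG kG ?VH kH) \<in> \<real>\<^sub>\<ge>\<^sub>0"
      using eval_f_viz_nonneg_iff[OF fin z01] by blast
  qed
next
  assume nonneg: "\<forall>nG kG nH kH. 0 < nG \<longrightarrow> 0 < kG \<longrightarrow> 0 < nH \<longrightarrow> 0 < kH \<longrightarrow> kG \<le> nG \<longrightarrow> kH \<le> nH \<longrightarrow>
       (\<forall>z \<in> variety K (viz_vars (VG nG kG nH kH) (VH nG kG nH kH))
               (I_viz K (VG nG kG nH kH) (DG nG kG nH kH) kG
                        (VH nG kG nH kH) (DH nG kG nH kH) kH).
          eval_rpoly z (f_viz (VG nG kG nH kH) kG (VH nG kG nH kH) kH) \<in> \<real>\<^sub>\<ge>\<^sub>0)"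
  show vizing_conjecture
    unfolding vizing_conjecture_def
  proof (intro allI impI)
    fix G H :: "nat pair_pre_digraph"
    assume G: "pair_graph G" and H: "pair_graph H"
    then have fin: "finite (pverts G)" "finite (pverts H)"
      and w: "parcs G \<subseteq> pverts G \<times> pverts G" "parcs H \<subseteq> pverts H \<times> pverts H"
      by (auto simp: pair_graph_iff)
    define nG kG nH kH where n_k_defs: "nG = card (pverts G)" "kG = domination_number G"
      "nH = card (pverts H)" "kH = domination_number H"
    \<comment> \<open>The whole vertex set is dominating.\<close>
    have le: "kG \<le> nG" "kH \<le> nH"
      unfolding n_k_defs using fin by (auto intro!: domination_number_le simp: dominating_def)
    let ?VG = "VG nG kG nH kH" and ?DG = "DG nG kG nH kH"
      and ?VH = "VH nG kG nH kH" and ?DH = "DH nG kG nH kH"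
    show "domination_number G * domination_number H \<le> domination_number (cart_prod G H)"
    \<comment> \<open>The parameters must be positive; a vanishing domination number makes the
      left-hand side 0. Otherwise \<open>le\<close> also makes \<open>nG\<close> and
      \<open>nH\<close> positive.\<close>
    proof (cases "kG = 0 \<or> kH = 0")
      case False
      then have pos: "0 < nG" "0 < kG" "0 < nH" "0 < kH" using le by auto
      have s: "viz_setting nG kG nH kH ?VG ?DG ?VH ?DH" using assms(2) pos le .
      then have V: "finite ?VG" "card ?VG = nG" "?DG \<subseteq> ?VG" "card ?DG = kG"
        "finite ?VH" "card ?VH = nH" "?DH \<subseteq> ?VH" "card ?DH = kH" "?VG \<inter> ?VH = {}"
        by (auto simp: viz_setting_def)
      obtain f where f: "bij_betw f (pverts G) ?VG" "dominating (map_graph f G) ?DG"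
        using transport_graph[OF G V(1) _ V(3)] V(2,4) n_k_defs by metis
      obtain k where k: "bij_betw k (pverts H) ?VH" "dominating (map_graph k H) ?DH"
        using transport_graph[OF H V(5) _ V(7)] V(6,8) n_k_defs by metis
      let ?G = "map_graph f G" and ?H = "map_graph k H"
      have inj: "inj_on f (pverts G)" "inj_on k (pverts H)"
        and verts: "pverts ?G = ?VG" "pverts ?H = ?VH"
        using f k by (auto simp: bij_betw_def)
      have graphs: "pair_graph ?G" "pair_graph ?H"
        using G H inj by (auto intro: pair_graph_map_graph)
      have dn: "domination_number ?G = kG" "domination_number ?H = kH"
        unfolding n_k_defs using w inj by (auto intro: domination_number_map_graph)
      have "finite (pverts (cart_prod ?G ?H))" using fin by simp
      \<comment> \<open>A minimum dominating set is taken, so that the lower bound on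
        \<open>card P\<close> obtained from the zero is a bound on the domination number of the
        product.\<close>
      then obtain P where P: "dominating (cart_prod ?G ?H) P"
        "card P = domination_number (cart_prod ?G ?H)"
        using domination_number_attained by blast
      then have "P \<subseteq> pverts ?G \<times> pverts ?H" by (simp add: dominating_def)
      let ?z = "viz_point ?G ?H P"
      have z: "point_graph ?z ?VG = ?G" "point_graph ?z ?VH = ?H" "point_set ?z ?VG ?VH = P"
        and z01: "?z \<in> viz_vars ?VG ?VH \<rightarrow>\<^sub>E {0, 1}"
        using point_graph_viz_point[OF graphs, of P] point_set_viz_point[of P ?G ?H]
          viz_point_in_PiE[of ?G ?H P] \<open>P \<subseteq> pverts ?G \<times> pverts ?H\<close> V(9)
        unfolding verts by auto
      have "?z \<in> variety K (viz_vars ?VG ?VH) (I_viz K ?VG ?DG kG ?VH ?DH kH)"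
        unfolding mem_variety_viz_iff[OF assms(1) pos(2,4) s] z
        using z01 f(2) k(2) dn P(1) by simp
      then have "eval_rpoly ?z (f_viz ?VG kG ?VH kH) \<in> \<real>\<^sub>\<ge>\<^sub>0"
        using nonneg pos le by blast
      then have "kG * kH \<le> domination_number (cart_prod ?G ?H)"
        using eval_f_viz_nonneg_iff[OF V(1,5) z01] z(3) P(2) by simp
      \<comment> \<open>The product of relabelled graphs is the relabelled product, and relabelling
        preserves the domination number; this returns to the original graphs.\<close>
      also have "\<dots> = domination_number (map_graph (map_prod f k) (cart_prod G H))"
        using w inj by (simp add: cart_prod_map_graph)
      also have "\<dots> = domination_number (cart_prod G H)"
        using pair_graph_cart_prod[OF G H] inj
        by (intro domination_number_map_graph) (auto simp: pair_graph_iff intro: map_prod_inj_on)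
      finally show ?thesis by (simp add: n_k_defs)
    qed (auto simp: n_k_defs)
  qed
qed

end
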